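(* Let $n\ge 1$ and $0\le m\le n$ be integers, and let $r_1>r_2>\cdots>r_m\ge 0$ and $s_{m+1}>\cdots>s_n\ge 0$ be sequences of non-negative integers such that $-r_j-\tfrac12\ne s_k+\tfrac12$ for all $1\le j\le m$ and $m+1\le k\le n$. Put $\mathbf r=(r_1,\dots,r_m)$, $\mathbf s=(s_{m+1},\dots,s_n)$, and let $G_{\mathbf r,\mathbf s}(q)$ be the coefficient of $t_1^{r_1+\frac12}\cdots t_m^{r_m+\frac12}\,t_{m+1}^{-s_{m+1}-\frac12}\cdots t_n^{-s_n-\frac12}$ in $F(t_1,\dots,t_n)$. Then the series $$\prod_{\substack{1\le j\le m\\ m+1\le k\le n}}\left(1-q^{r_j+s_k+1}\right)\prod_{1\le k<\ell\le m}\left(1-q^{r_k-r_\ell}\right)\prod_{m+1\le k<\ell\le n}\left(1-q^{s_k-s_\ell}\right)\,G_{\mathbf r,\mathbf s}(q)$$ can be written as $$P(q)\sum_{\ell\ge 0}(-1)^\ell q^{\frac{\ell(\ell+1)}2}+Q(q)$$ for unique Laurent polynomials $P$ and $Q$ in $q$.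
   Context: Fermionic Fock space: let $\psi(k+\tfrac12),\psi^*(k+\tfrac12)$, $k\in\mathbb Z$, satisfy $[\psi^*(\ell+\tfrac12),\psi(k+\tfrac12)]_+=\delta_{\ell+k+1,0}$ for $\ell,k\in\mathbb{Z}$, all other anticommutators being zero. $\mathcal F$ is the complex vector space generated from a vacuum vector $\mathbf 1$, annihilated by all $\psi(k+\tfrac12)$ and $\psi^*(k+\tfrac12)$ with $k\ge 0$, with basis the monomials $\psi(-n_a-\tfrac12)\cdots\psi(-n_1-\tfrac12)\psi^*(-m_b-\tfrac12)\cdots\psi^*(-m_1-\tfrac12)\mathbf 1$, where $n_a>\cdots>n_1\ge0$ and $m_b>\cdots>m_1\ge 0$. Such a monomial has charge $a-b$ and is an eigenvector of $L(0)$ with eigenvalue $\sum_i(n_i+\tfrac12)+\sum_i(m_i+\tfrac12)$. $\mathcal F_0$ is the span of the monomials of charge $0$. Let $A(t)=\sum_{\ell\in\mathbb Z}\psi^*(\ell+\tfrac12)\psi(-\ell-\tfrac12)\,t^{-\ell-\frac12}$, and define the Bloch-Okounkov $n$-point function (a formal series in the $t_j$, whose coefficients are power series in $q=e^{2\pi i\tau}$, $|q|<1$) by $$F(t_1,\dots,t_n)=\eta(\tau)\,\mathrm{tr}_{\mathcal F_0}A(t_1)\cdots A(t_n)\,q^{L(0)-\frac1{24}},\qquad \eta(\tau)=q^{\frac1{24}}\prod_{m\ge1}(1-q^m).$$ *)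

theory Defs
  imports
    "HOL-Analysis.Analysis"
    "HOL-Computational_Algebra.Formal_Laurent_Series"
    "HOL-Library.Poly_Mapping"
    "HOL-Library.FSet"
begin

section \<open>Fermionic Fock space\<close>

text \<open>
  Modes are indexed by rationals and only their values at half-integers matter. The monomial
  attached to \<open>N = {n\<^sub>1 < \<dots> < n\<^sub>a}\<close> and \<open>M = {m\<^sub>1 < \<dots> < m\<^sub>b}\<close> is
  \<open>\<psi>(-n\<^sub>a-1/2) \<dots> \<psi>(-n\<^sub>1-1/2) \<psi>\<^sup>*(-m\<^sub>b-1/2) \<dots> \<psi>\<^sup>*(-m\<^sub>1-1/2) \<one>\<close>: \<open>fold\<close> along an
  increasing list applies the operator of the largest index last.
\<close>

definition fock_monomial ::
    "(rat \<Rightarrow> 'v \<Rightarrow> 'v) \<Rightarrow> (rat \<Rightarrow> 'v \<Rightarrow> 'v) \<Rightarrow> 'v \<Rightarrow> nat set \<Rightarrow> nat set \<Rightarrow> 'v" where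
  "fock_monomial \<psi> \<psi>s vac N M =
     fold (\<lambda>n. \<psi> (- of_nat n - 1/2)) (sorted_list_of_set N)
       (fold (\<lambda>m. \<psi>s (- of_nat m - 1/2)) (sorted_list_of_set M) vac)"

locale fermionic_fock = vector_space scale
  for scale :: "complex \<Rightarrow> 'v::ab_group_add \<Rightarrow> 'v" +
  fixes \<psi> \<psi>s :: "rat \<Rightarrow> 'v \<Rightarrow> 'v" and vac :: 'v
  assumes linear_psi: "\<And>k::int. Vector_Spaces.linear scale scale (\<psi> (of_int k + 1/2))"
    and linear_psi_star: "\<And>k::int. Vector_Spaces.linear scale scale (\<psi>s (of_int k + 1/2))"
    and anticomm_star_psi: "\<And>(l::int) (k::int) v.
      \<psi>s (of_int l + 1/2) (\<psi> (of_int k + 1/2) v) + \<psi> (of_int k + 1/2) (\<psi>s (of_int l + 1/2) v)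
        = (if l + k + 1 = 0 then v else 0)"
    and anticomm_psi_psi: "\<And>(l::int) (k::int) v.
      \<psi> (of_int l + 1/2) (\<psi> (of_int k + 1/2) v) + \<psi> (of_int k + 1/2) (\<psi> (of_int l + 1/2) v) = 0"
    and anticomm_star_star: "\<And>(l::int) (k::int) v.
      \<psi>s (of_int l + 1/2) (\<psi>s (of_int k + 1/2) v) + \<psi>s (of_int k + 1/2) (\<psi>s (of_int l + 1/2) v) = 0"
    and psi_vac: "\<And>k::int. k \<ge> 0 \<Longrightarrow> \<psi> (of_int k + 1/2) vac = 0"
    and psi_star_vac: "\<And>k::int. k \<ge> 0 \<Longrightarrow> \<psi>s (of_int k + 1/2) vac = 0"
    and inj_monomials:
      "inj_on (\<lambda>(N, M). fock_monomial \<psi> \<psi>s vac N M) {(N, M). finite N \<and> finite M}"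
    and independent_monomials:
      "independent ((\<lambda>(N, M). fock_monomial \<psi> \<psi>s vac N M) ` {(N, M). finite N \<and> finite M})"
    and span_monomials:
      "span ((\<lambda>(N, M). fock_monomial \<psi> \<psi>s vac N M) ` {(N, M). finite N \<and> finite M}) = UNIV"

definition charge :: "nat set \<Rightarrow> nat set \<Rightarrow> int" where
  "charge N M = int (card N) - int (card M)"

definition energy :: "nat set \<Rightarrow> nat set \<Rightarrow> rat" where
  "energy N M = (\<Sum>n\<in>N. of_nat n + 1/2) + (\<Sum>m\<in>M. of_nat m + 1/2)"

definition charge0_states :: "nat \<Rightarrow> (nat set \<times> nat set) set" where
  "charge0_states d =
     {(N, M). finite N \<and> finite M \<and> charge N M = 0 \<and> energy N M = of_nat d}"

lemma finite_charge0_states: "finite (charge0_states d)"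
proof (rule finite_subset)
  have bound: "n \<le> d" if fin: "finite X" and n: "n \<in> X" and le: "(\<Sum>x\<in>X. of_nat x + 1/2) \<le> (of_nat d :: rat)"
    for n and X :: "nat set"
  proof -
    have "(of_nat n :: rat) + 1/2 \<le> (\<Sum>x\<in>X. of_nat x + 1/2)"
      by (rule member_le_sum[OF n _ fin, of "\<lambda>x. of_nat x + 1/2 :: rat"]) auto
    with le have "(of_nat n :: rat) \<le> of_nat d" by linarith
    then show ?thesis by simp
  qed
  show "charge0_states d \<subseteq> Pow {..d} \<times> Pow {..d}"
  proof (clarsimp simp: charge0_states_def, intro conjI subsetI)
    fix N M :: "nat set" and n
    assume *: "finite N" "finite M" "energy N M = of_nat d"
    have nn: "0 \<le> (\<Sum>n\<in>N. of_nat n + 1/2 :: rat)" "0 \<le> (\<Sum>n\<in>M. of_nat n + 1/2 :: rat)"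
      by (auto intro: sum_nonneg)
    show "n \<in> {..d}" if "n \<in> N"
      using bound[OF *(1) that] *(3) nn by (simp add: energy_def)
    show "n \<in> {..d}" if "n \<in> M"
      using bound[OF *(2) that] *(3) nn by (simp add: energy_def)
  qed
qed simp

lemma charge0_energy_in_Nats:
  assumes "finite N" "finite M" "charge N M = 0"
  shows "energy N M \<in> \<nat>"
proof -
  have c: "card N = card M" using assms by (simp add: charge_def)
  have "energy N M = of_nat (\<Sum>N + \<Sum>M + card M)"
    by (simp add: energy_def sum.distrib c)
  then show ?thesis by (metis of_nat_in_Nats)
qed

section \<open>The n-point function\<close>

context fermionic_fock
begin

abbreviation monomial :: "nat set \<Rightarrow> nat set \<Rightarrow> 'v" where
  "monomial \<equiv> fock_monomial \<psi> \<psi>s vac"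

definition monomials :: "'v set" where
  "monomials = (\<lambda>(N, M). monomial N M) ` {(N, M). finite N \<and> finite M}"

text \<open>
  The coefficient of \<open>t\<^sup>e\<close> in \<open>A(t)\<close>; the summand of index \<open>\<ell>\<close> has \<open>e = -\<ell>-1/2\<close>.
\<close>

definition A_coeff :: "rat \<Rightarrow> 'v \<Rightarrow> 'v" where
  "A_coeff e v = (if \<exists>l::int. e = - of_int l - 1/2 then \<psi>s (- e) (\<psi> e v) else 0)"

text \<open>
  \<open>tr\<^bsub>F\<^sub>0\<^esub> X q\<^bsup>L(0)\<^esup>\<close> as a formal power series in \<open>q\<close>: the coefficient of \<open>q\<^sup>d\<close> is the sum of the
  diagonal matrix entries of \<open>X\<close> over the monomials of charge 0 with \<open>L(0)\<close>-eigenvalue \<open>d\<close>.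
  There are finitely many of these for each \<open>d\<close>, and all \<open>L(0)\<close>-eigenvalues in charge 0 are
  natural numbers.
\<close>

definition trace_charge0 :: "('v \<Rightarrow> 'v) \<Rightarrow> complex fps" where
  "trace_charge0 X = Abs_fps (\<lambda>d. \<Sum>(N, M)\<in>charge0_states d.
     representation monomials (X (monomial N M)) (monomial N M))"

text \<open>
  The coefficient of \<open>t\<^sub>1\<^bsup>e 1\<^esup> \<dots> t\<^sub>n\<^bsup>e n\<^esup>\<close> in \<open>F(t\<^sub>1, \<dots>, t\<^sub>n)\<close>. The factor \<open>q\<^bsup>1/24\<^esup>\<close> of \<open>\<eta>(\<tau>)\<close>
  cancels against the \<open>q\<^bsup>-1/24\<^esup>\<close> in the trace, leaving \<open>\<Prod>\<^bsub>m\<ge>1\<^esub> (1 - q\<^sup>m)\<close>.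
\<close>

definition npoint_coeff :: "nat \<Rightarrow> (nat \<Rightarrow> rat) \<Rightarrow> complex fps" where
  "npoint_coeff n e =
     prodinf (\<lambda>m. 1 - fps_X ^ Suc m) * trace_charge0 (foldr (\<lambda>j. A_coeff (e j)) [1..<Suc n])"

definition G :: "nat \<Rightarrow> nat \<Rightarrow> (nat \<Rightarrow> nat) \<Rightarrow> (nat \<Rightarrow> nat) \<Rightarrow> complex fps" where
  "G n m r s =
     npoint_coeff n (\<lambda>j. if j \<le> m then of_nat (r j) + 1/2 else - of_nat (s j) - 1/2)"

end

definition partial_theta :: "complex fps" where
  "partial_theta = suminf (\<lambda>l. (-1) ^ l * fps_X ^ (l * (l + 1) div 2))"

definition laurent_polynomial :: "complex fls \<Rightarrow> bool" where
  "laurent_polynomial f \<longleftrightarrow> finite {k. fls_nth f k \<noteq> 0}"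

section \<open>Consistency of the Fock space axioms\<close>

text \<open>
  A model: finitely supported functions on the finite sets of occupied modes, where \<open>\<psi>(-n-1/2)\<close>
  creates the mode \<open>n\<close> and \<open>\<psi>\<^sup>*(-m-1/2)\<close> creates the mode \<open>-m-1\<close>. Its monomials are the point masses
  up to a nonzero scalar.
\<close>

type_synonym fock_model = "int fset \<Rightarrow>\<^sub>0 complex"

lift_definition model_scale :: "complex \<Rightarrow> fock_model \<Rightarrow> fock_model" is "\<lambda>c f S. c * f S"
  by (erule rev_finite_subset) auto

definition model_sign :: "int \<Rightarrow> int fset \<Rightarrow> complex" where
  "model_sign i S = (-1) ^ card {j. j |\<in>| S \<and> j < i}"

lift_definition model_create :: "int \<Rightarrow> fock_model \<Rightarrow> fock_model" is
  "\<lambda>i f S. if i |\<in>| S then model_sign i S * f (S |-| {|i|}) else 0"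
proof -
  fix i :: int and f :: "int fset \<Rightarrow> complex"
  assume fin: "finite {S. f S \<noteq> 0}"
  show "finite {S. (if i |\<in>| S then model_sign i S * f (S |-| {|i|}) else 0) \<noteq> 0}"
  proof (rule finite_subset)
    show "{S. (if i |\<in>| S then model_sign i S * f (S |-| {|i|}) else 0) \<noteq> 0} \<subseteq> finsert i ` {S. f S \<noteq> 0}"
    proof (clarsimp split: if_splits)
      fix S assume "i |\<in>| S" "f (S |-| {|i|}) \<noteq> 0"
      then show "S \<in> finsert i ` {S. f S \<noteq> 0}"
        by (intro image_eqI[of _ _ "S |-| {|i|}"]) auto
    qed
  qed (use fin in simp)
qed

lift_definition model_annihilate :: "int \<Rightarrow> fock_model \<Rightarrow> fock_model" is
  "\<lambda>i f S. if i |\<in>| S then 0 else model_sign i S * f (finsert i S)"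
proof -
  fix i :: int and f :: "int fset \<Rightarrow> complex"
  assume fin: "finite {S. f S \<noteq> 0}"
  show "finite {S. (if i |\<in>| S then 0 else model_sign i S * f (finsert i S)) \<noteq> 0}"
  proof (rule finite_subset)
    show "{S. (if i |\<in>| S then 0 else model_sign i S * f (finsert i S)) \<noteq> 0}
            \<subseteq> (\<lambda>S. S |-| {|i|}) ` {S. f S \<noteq> 0}"
    proof (clarsimp split: if_splits)
      fix S assume "i |\<notin>| S" "f (finsert i S) \<noteq> 0"
      then show "S \<in> (\<lambda>S. S |-| {|i|}) ` {S. f S \<noteq> 0}"
        by (intro image_eqI[of _ _ "finsert i S"]) auto
    qed
  qed (use fin in simp)
qed

definition model_psi :: "rat \<Rightarrow> fock_model \<Rightarrow> fock_model" where
  "model_psi x = (let i = \<lfloor>- x\<rfloor> in if i \<ge> 0 then model_create i else model_annihilate i)"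

definition model_psi_star :: "rat \<Rightarrow> fock_model \<Rightarrow> fock_model" where
  "model_psi_star x = (let i = \<lfloor>x\<rfloor> in if i \<ge> 0 then model_annihilate i else model_create i)"

definition model_vac :: fock_model where
  "model_vac = Poly_Mapping.single {||} 1"

lemma floor_half: "\<lfloor>(of_int k + 1/2 :: rat)\<rfloor> = k" "\<lfloor>- (of_int k + 1/2 :: rat)\<rfloor> = - k - 1"
   by linarith+

lemma model_psi_half:
  "model_psi (of_int k + 1/2) =
     (if - k - 1 \<ge> 0 then model_create (- k - 1) else model_annihilate (- k - 1))"
  unfolding model_psi_def Let_def floor_half by simp

lemma model_psi_star_half:
  "model_psi_star (of_int k + 1/2) = (if k \<ge> 0 then model_annihilate k else model_create k)"
  unfolding model_psi_star_def Let_def floor_half by simp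

lemma model_sign_simps [simp]:
  "j |\<notin>| S \<Longrightarrow> model_sign i (finsert j S) = (if j < i then - model_sign i S else model_sign i S)"
  "model_sign i S * model_sign i S = 1"
  "model_sign i S * (model_sign i S * x) = x"
proof -
  assume j: "j |\<notin>| S"
  have fin: "finite {j'. j' |\<in>| S \<and> j' < i}"
    by (rule finite_subset[of _ "fset S"]) auto
  have "{j'. j' |\<in>| finsert j S \<and> j' < i} =
     (if j < i then insert j {j'. j' |\<in>| S \<and> j' < i} else {j'. j' |\<in>| S \<and> j' < i})" by auto
  then show "model_sign i (finsert j S) = (if j < i then - model_sign i S else model_sign i S)"
    using j fin by (simp add: model_sign_def)
next
  show sq: "model_sign i S * model_sign i S = 1"
    by (simp add: model_sign_def flip: power_mult_distrib)
  show "model_sign i S * (model_sign i S * x) = x"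
    using sq by (simp flip: mult.assoc)
qed

lemma model_sign_minus [simp]:
  "j |\<in>| S \<Longrightarrow> model_sign i (S |-| {|j|}) = (if j < i then - model_sign i S else model_sign i S)"
  using model_sign_simps(1)[of j "S |-| {|j|}" i] by (auto simp: finsert_absorb split: if_splits)

lemma model_anticomm:
  "model_create i (model_create j p) + model_create j (model_create i p) = 0"
  "model_annihilate i (model_annihilate j p) + model_annihilate j (model_annihilate i p) = 0"
  "model_annihilate i (model_create j p) + model_create j (model_annihilate i p)
     = (if i = j then p else 0)"
proof -
  have c: "S |-| {|i|} |-| {|j|} = S |-| {|j|} |-| {|i|}" for S :: "int fset" by auto
  have d: "finsert i S |-| {|j|} = finsert i (S |-| {|j|})" if "i \<noteq> j" for S :: "int fset"
    using that by auto
  show "model_create i (model_create j p) + model_create j (model_create i p) = 0"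
    by (rule poly_mapping_eqI) (auto simp: lookup_add model_create.rep_eq c)
  show "model_annihilate i (model_annihilate j p) + model_annihilate j (model_annihilate i p) = 0"
    by (rule poly_mapping_eqI)
      (auto simp: lookup_add model_annihilate.rep_eq finsert_commute[of i j])
  have e: "finsert i (S |-| {|i|}) = S" if "i |\<in>| S" for S :: "int fset" using that by auto
  have f: "finsert i S |-| {|i|} = S" if "i |\<notin>| S" for S :: "int fset" using that by auto
  show "model_annihilate i (model_create j p) + model_create j (model_annihilate i p)
     = (if i = j then p else 0)"
  proof (cases "i = j")
    case True
    show ?thesis unfolding True[symmetric]
    proof (rule poly_mapping_eqI)
      fix S
      show "Poly_Mapping.lookup (model_annihilate i (model_create i p) + model_create i (model_annihilate i p)) S
          = Poly_Mapping.lookup (if i = i then p else 0) S"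
        by (cases "i |\<in>| S")
          (simp_all add: lookup_add model_annihilate.rep_eq model_create.rep_eq e f finsert_absorb)
    qed
  next
    case False
    show ?thesis
    proof (rule poly_mapping_eqI)
      fix S
      show "Poly_Mapping.lookup (model_annihilate i (model_create j p) + model_create j (model_annihilate i p)) S
          = Poly_Mapping.lookup (if i = j then p else 0) S"
        using False by (cases "i |\<in>| S"; cases "j |\<in>| S")
          (simp_all add: lookup_add model_annihilate.rep_eq model_create.rep_eq d)
    qed
  qed
qed

interpretation model: vector_space model_scale
  by standard
    (auto intro!: poly_mapping_eqI simp: model_scale.rep_eq lookup_add algebra_simps)

lemma linear_model:
  "Vector_Spaces.linear model_scale model_scale (model_create i)"
  "Vector_Spaces.linear model_scale model_scale (model_annihilate i)"
  by (unfold_locales;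
      auto intro!: poly_mapping_eqI
        simp: model_scale.rep_eq model_create.rep_eq model_annihilate.rep_eq lookup_add algebra_simps)+

lemma model_create_single:
  "i |\<notin>| S \<Longrightarrow> model_create i (Poly_Mapping.single S c) =
     Poly_Mapping.single (finsert i S) (model_sign i S * c)"
  by (rule poly_mapping_eqI)
     (auto simp: model_create.rep_eq lookup_single when_def)

definition model_key :: "nat set \<Rightarrow> nat set \<Rightarrow> int fset" where
  "model_key N M = Abs_fset (int ` N \<union> (\<lambda>m. - int m - 1) ` M)"

lemma fset_model_key:
  "finite N \<Longrightarrow> finite M \<Longrightarrow> fset (model_key N M) = int ` N \<union> (\<lambda>m. - int m - 1) ` M"
  by (simp add: model_key_def Abs_fset_inverse)

lemma fold_model:
  assumes op: "\<And>x. F x = model_create (h x)" and h: "inj h"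
    and "distinct xs" and "\<And>x. x \<in> set xs \<Longrightarrow> h x |\<notin>| S" and "c \<noteq> 0"
  shows "\<exists>c'. c' \<noteq> 0 \<and> fold F xs (Poly_Mapping.single S c) =
           Poly_Mapping.single (fset_of_list (map h xs) |\<union>| S) c'"
  using assms(3-)
proof (induction xs arbitrary: S c)
  case Nil
  then show ?case by auto
next
  case (Cons x xs)
  have "model_sign (h x) S \<noteq> 0" by (simp add: model_sign_def)
  then have "\<exists>c'. c' \<noteq> 0 \<and> fold F xs (Poly_Mapping.single (finsert (h x) S) (model_sign (h x) S * c)) =
      Poly_Mapping.single (fset_of_list (map h xs) |\<union>| finsert (h x) S) c'"
    using Cons.prems h by (intro Cons.IH) (auto dest: injD)
  then show ?case using Cons.prems
    by (simp add: op[of x] model_create_single)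
qed

lemma model_monomial:
  assumes "finite N" "finite M"
  shows "\<exists>c. c \<noteq> 0 \<and> fock_monomial model_psi model_psi_star model_vac N M
           = Poly_Mapping.single (model_key N M) c"
proof -
  have fl: "\<lfloor>- (- of_nat n - 1/2 :: rat)\<rfloor> = int n" "\<lfloor>(- of_nat n - 1/2 :: rat)\<rfloor> = - int n - 1" for n
    by linarith+
  have 1: "model_psi (- of_nat n - 1/2) = model_create (int n)" for n
    unfolding model_psi_def fl Let_def by simp
  have 2: "model_psi_star (- of_nat n - 1/2) = model_create (- int n - 1)" for n
    unfolding model_psi_star_def fl Let_def by simp
  let ?S = "fset_of_list (map (\<lambda>m. - int m - 1) (sorted_list_of_set M))"
  obtain c where c: "c \<noteq> 0" "fold (\<lambda>m. model_psi_star (- of_nat m - 1/2)) (sorted_list_of_set M) model_vac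
      = Poly_Mapping.single ?S c"
    using fold_model[of "\<lambda>m. model_psi_star (- of_nat m - 1/2)" "\<lambda>m. - int m - 1"
        "sorted_list_of_set M" "{||}" 1, OF 2]
    by (auto simp: model_vac_def inj_def)
  have disj: "int n |\<notin>| ?S" for n
    by (auto simp: fset_of_list_elem simp del: fset_of_list_map)
  obtain c' where "c' \<noteq> 0" "fock_monomial model_psi model_psi_star model_vac N M
      = Poly_Mapping.single (fset_of_list (map int (sorted_list_of_set N)) |\<union>| ?S) c'"
    using fold_model[of "\<lambda>n. model_psi (- of_nat n - 1/2)" int
        "sorted_list_of_set N" ?S c, OF 1 inj_of_nat] c disj
    by (auto simp: fock_monomial_def simp del: fset_of_list_map)
  moreover have "fset_of_list (map int (sorted_list_of_set N)) |\<union>| ?S = model_key N M"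
    using assms by (intro fset_inject[THEN iffD1]) (simp add: fset_model_key fset_of_list.rep_eq)
  ultimately show ?thesis by auto
qed

lemma inj_model_key:
  assumes "finite N" "finite M" "finite N'" "finite M'" "model_key N M = model_key N' M'"
  shows "N = N'" "M = M'"
proof -
  have eq: "int ` N \<union> (\<lambda>m. - int m - 1) ` M = int ` N' \<union> (\<lambda>m. - int m - 1) ` M'"
    using assms fset_model_key by metis
  have 1: "{n. int n \<in> int ` A \<union> (\<lambda>m. - int m - 1) ` B} = A"
   and 2: "{n. - int n - 1 \<in> int ` A \<union> (\<lambda>m. - int m - 1) ` B} = B" for A B by auto
  show "N = N'" using 1[of N M] 1[of N' M'] unfolding eq by simp
  show "M = M'" using 2[of N M] 2[of N' M'] unfolding eq by simp
qed

lemma surj_model_key: "\<exists>N M. finite N \<and> finite M \<and> model_key N M = S"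
proof (intro exI conjI)
  let ?N = "{n. int n \<in> fset S}" and ?M = "{m. - int m - 1 \<in> fset S}"
  show f: "finite ?N" "finite ?M"
    using finite_vimageI[of "fset S" int] finite_vimageI[of "fset S" "\<lambda>m. - int m - 1"]
    by (auto simp: vimage_def inj_def)
  have "x \<in> int ` ?N \<union> (\<lambda>m. - int m - 1) ` ?M" if "x \<in> fset S" for x
  proof (cases "x \<ge> 0")
    case True
    then show ?thesis using that by (auto intro!: image_eqI[of _ _ "nat x"])
  next
    case False
    then show ?thesis using that by (auto intro!: image_eqI[of _ _ "nat (- x - 1)"])
  qed
  then show "model_key ?N ?M = S"
    by (intro fset_inject[THEN iffD1]) (auto simp: fset_model_key[OF f])
qed

theorem fermionic_fock_model:
  "fermionic_fock model_scale model_psi model_psi_star model_vac"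
proof -
  let ?mon = "fock_monomial model_psi model_psi_star model_vac"
  let ?I = "{(N, M). finite N \<and> finite M} :: (nat set \<times> nat set) set"
  let ?B = "(\<lambda>(N, M). ?mon N M) ` ?I"
  obtain c :: "nat set \<Rightarrow> nat set \<Rightarrow> complex" where c: "\<And>N M. finite N \<Longrightarrow> finite M \<Longrightarrow> c N M \<noteq> 0"
      "\<And>N M. finite N \<Longrightarrow> finite M \<Longrightarrow> ?mon N M = Poly_Mapping.single (model_key N M) (c N M)"
    using model_monomial by metis
  have inj: "inj_on (\<lambda>(N, M). ?mon N M) ?I"
  proof (rule inj_onI, clarsimp)
    fix N M N' M' :: "nat set"
    assume fin: "finite N" "finite M" "finite N'" "finite M'" and eq: "?mon N M = ?mon N' M'"
    from eq have "Poly_Mapping.keys (?mon N M) = Poly_Mapping.keys (?mon N' M')" by simp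
    then have "model_key N M = model_key N' M'"
      unfolding c(2)[OF fin(1,2)] c(2)[OF fin(3,4)] using c(1) fin by simp
    then show "N = N' \<and> M = M'" using inj_model_key[OF fin] by simp
  qed
  have ind: "model.independent ?B"
    unfolding model.independent_explicit_module
  proof (intro allI impI)
    fix t u v assume t: "finite t" "t \<subseteq> ?B" "(\<Sum>v\<in>t. model_scale (u v) v) = 0" "v \<in> t"
    then obtain N M where NM: "finite N" "finite M" "v = ?mon N M" by auto
    let ?S = "model_key N M"
    have "Poly_Mapping.lookup w ?S = 0" if w: "w \<in> t" "w \<noteq> v" for w
    proof -
      from w t obtain N' M' where NM': "finite N'" "finite M'" "w = ?mon N' M'" by auto
      then have "model_key N' M' \<noteq> ?S"
        using w NM inj_model_key[OF NM'(1,2) NM(1,2)] by auto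
      then show ?thesis using NM' c by (simp add: lookup_single_not_eq)
    qed
    then have "(\<Sum>w\<in>t. u w * Poly_Mapping.lookup w ?S) = (\<Sum>w\<in>{v}. u w * Poly_Mapping.lookup w ?S)"
      using t by (intro sum.mono_neutral_right) auto
    moreover have "(\<Sum>w\<in>t. u w * Poly_Mapping.lookup w ?S) = 0"
      using arg_cong[OF t(3), of "\<lambda>p. Poly_Mapping.lookup p ?S"] by (simp add: lookup_sum model_scale.rep_eq)
    ultimately show "u v = 0" using NM c by simp
  qed
  have span: "model.span ?B = UNIV"
  proof (intro equalityI subsetI UNIV_I)
    fix p :: fock_model
    have single: "Poly_Mapping.single S a \<in> model.span ?B" for S a
    proof -
      obtain N M where NM: "finite N" "finite M" "model_key N M = S" using surj_model_key by blast
      then have "Poly_Mapping.single S a = model_scale (a / c N M) (?mon N M)"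
        using c by (intro poly_mapping_eqI) (simp add: model_scale.rep_eq lookup_single when_def)
      moreover have "?mon N M \<in> ?B" using NM by auto
      ultimately show ?thesis by (simp add: model.span_base model.span_scale)
    qed
    have "p = (\<Sum>S\<in>Poly_Mapping.keys p. Poly_Mapping.single S (Poly_Mapping.lookup p S))"
      by (rule poly_mapping_eqI)
        (auto simp: lookup_sum lookup_single when_def sum.delta in_keys_iff)
    then show "p \<in> model.span ?B" by (metis (no_types, lifting) single model.span_sum)
  qed
  have vac: "model_annihilate i model_vac = 0" for i
    by (rule poly_mapping_eqI)
      (auto simp: model_annihilate.rep_eq model_vac_def lookup_single when_def)
  show ?thesis
  proof (rule fermionic_fock.intro, rule model.vector_space_axioms, rule fermionic_fock_axioms.intro)
    fix k l :: int and v :: fock_model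
    show "Vector_Spaces.linear model_scale model_scale (model_psi (of_int k + 1/2))"
      unfolding model_psi_half using linear_model by presburger
    show "Vector_Spaces.linear model_scale model_scale (model_psi_star (of_int k + 1/2))"
      unfolding model_psi_star_half using linear_model by presburger
    show "model_psi_star (of_int l + 1/2) (model_psi (of_int k + 1/2) v)
        + model_psi (of_int k + 1/2) (model_psi_star (of_int l + 1/2) v)
        = (if l + k + 1 = 0 then v else 0)"
    proof -
      have "l + k + 1 = 0 \<longleftrightarrow> l = - k - 1" by linarith
      then show ?thesis
        unfolding model_psi_half model_psi_star_half
        using model_anticomm(1)[of l "- k - 1" v] model_anticomm(2)[of l "- k - 1" v]
          model_anticomm(3)[of l "- k - 1" v] model_anticomm(3)[of "- k - 1" l v]
        by (cases "l \<ge> 0"; cases "- k - 1 \<ge> 0") (simp_all add: add.commute)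
    qed
    show "model_psi (of_int l + 1/2) (model_psi (of_int k + 1/2) v)
        + model_psi (of_int k + 1/2) (model_psi (of_int l + 1/2) v) = 0"
      unfolding model_psi_half
      using model_anticomm(1)[of "- l - 1" "- k - 1" v] model_anticomm(2)[of "- l - 1" "- k - 1" v]
        model_anticomm(3)[of "- l - 1" "- k - 1" v] model_anticomm(3)[of "- k - 1" "- l - 1" v]
      by (cases "- l - 1 \<ge> 0"; cases "- k - 1 \<ge> 0") (auto simp: add.commute split: if_splits)
    show "model_psi_star (of_int l + 1/2) (model_psi_star (of_int k + 1/2) v)
        + model_psi_star (of_int k + 1/2) (model_psi_star (of_int l + 1/2) v) = 0"
      unfolding model_psi_star_half
      using model_anticomm(1)[of l k v] model_anticomm(2)[of l k v]
        model_anticomm(3)[of l k v] model_anticomm(3)[of k l v]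
      by (cases "l \<ge> 0"; cases "k \<ge> 0") (auto simp: add.commute split: if_splits)
    show "model_psi (of_int k + 1/2) model_vac = 0" if "k \<ge> 0"
      unfolding model_psi_half using that vac by simp
    show "model_psi_star (of_int k + 1/2) model_vac = 0" if "k \<ge> 0"
      unfolding model_psi_star_half using that vac by simp
  qed (fact inj ind span)+
qed

end

theory Submission
  imports Defs
begin

text \<open>
  The coefficient of \<open>t\<^bsup>-x-1/2\<^esup>\<close> in \<open>A(t)\<close> is diagonal in the monomial basis: it projects onto the
  monomials whose Maya diagram is vacant at the site \<open>x\<close>. Hence \<open>G\<close> is the product \<open>\<Prod>\<^sub>m (1 - q\<^sup>m)\<close>
  times \<open>V(I)\<close>, the generating function by energy of the charge 0 diagrams that are vacant on a set
  \<open>I\<close> of \<open>n\<close> sites.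

  Removing a particle at \<open>x\<close> and translating the remaining diagram by one site preserves charge 0
  and lowers the energy by \<open>x + 1\<close>. Therefore
  \<open>V(I) = V(I \<union> {x}) + q\<^bsup>x+1\<^esup> V((I \<union> {x}) + 1)\<close> for \<open>x \<notin> I\<close>.
  With \<open>I = {k + 1, k + 2, \<dots>}\<close> and \<open>x = k\<close>, where \<open>k \<ge> 0\<close>, this yields Euler's identity
  \<open>\<Prod>\<^sub>m (1 - q\<^sup>m) V(\<emptyset>) = 1\<close>; with \<open>I = \<emptyset>\<close> it relates \<open>V({x})\<close> to \<open>V({x + 1})\<close> and unrolls from
  \<open>x = 0\<close> to the partial theta series; applied to two sites \<open>a\<close>, \<open>b\<close> it gives
  \<open>(1 - q\<^bsup>b-a\<^esup>) V(I \<union> {a, b}) = V(I \<union> {a}) - q\<^bsup>b-a\<^esup> V(I \<union> {b})\<close>,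
  which reduces every \<open>V(I)\<close> to singletons. Uniqueness holds because the gaps between the exponents
  of the partial theta series are unbounded.
\<close>

unbundle no vec_syntax
unbundle fps_syntax

declare fls_X_power_int [simp del]

section \<open>Laurent polynomials and lacunary series\<close>

lemma fls_X_powi_nth: "(fls_X powi x :: 'a::division_ring fls) $$ k = (if k = x then 1 else 0)"
  by (simp add: fls_X_power_int)

lemma fls_X_powi_mult_nth: "(fls_X powi x * f) $$ k = f $$ (k - x)"
  for f :: "'a::division_ring fls"
  by (simp add: fls_X_power_int fls_X_intpow_times_conv_shift)

lemma fps_to_fls_X_power: "fps_to_fls (fps_X ^ k :: 'a::division_ring fps) = fls_X powi int k"
  by (simp add: fps_to_fls_power)

lemma fps_to_fls_prod: "fps_to_fls (\<Prod>i\<in>A. f i) = (\<Prod>i\<in>A. fps_to_fls (f i))"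
  for f :: "'b \<Rightarrow> 'a::comm_ring_1 fps"
  by (induction A rule: infinite_finite_induct) (simp_all add: fls_times_fps_to_fls)

lemma laurent_polynomial_subset:
  "finite S \<Longrightarrow> {k. f $$ k \<noteq> 0} \<subseteq> S \<Longrightarrow> laurent_polynomial f"
  unfolding laurent_polynomial_def by (rule finite_subset)

lemma laurent_polynomial_0 [simp]: "laurent_polynomial 0"
  by (simp add: laurent_polynomial_def)

lemma laurent_polynomial_X_powi [simp]: "laurent_polynomial (fls_X powi x)"
  by (rule laurent_polynomial_subset[of "{x}"]) (auto simp: fls_X_powi_nth split: if_splits)

lemma laurent_polynomial_1 [simp]: "laurent_polynomial 1"
  using laurent_polynomial_X_powi[of 0] by simp

lemma laurent_polynomial_uminus [simp]: "laurent_polynomial (- f) \<longleftrightarrow> laurent_polynomial f"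
  by (simp add: laurent_polynomial_def)

lemma laurent_polynomial_add:
  assumes "laurent_polynomial f" "laurent_polynomial g"
  shows "laurent_polynomial (f + g)"
  using assms unfolding laurent_polynomial_def[of f] laurent_polynomial_def[of g]
  by (intro laurent_polynomial_subset[of "{k. f $$ k \<noteq> 0} \<union> {k. g $$ k \<noteq> 0}"]) auto

lemma laurent_polynomial_diff:
  "laurent_polynomial f \<Longrightarrow> laurent_polynomial g \<Longrightarrow> laurent_polynomial (f - g)"
  using laurent_polynomial_add[of f "- g"] by simp

lemma laurent_polynomial_mult:
  assumes "laurent_polynomial f" "laurent_polynomial g"
  shows "laurent_polynomial (f * g)"
proof (rule laurent_polynomial_subset)
  let ?S = "(\<lambda>(i, j). i + j) ` ({k. f $$ k \<noteq> 0} \<times> {k. g $$ k \<noteq> 0})"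
  show "finite ?S" using assms by (simp add: laurent_polynomial_def)
  show "{k. (f * g) $$ k \<noteq> 0} \<subseteq> ?S"
  proof
    fix k assume "k \<in> {k. (f * g) $$ k \<noteq> 0}"
    then obtain i where "f $$ i * g $$ (k - i) \<noteq> 0"
      unfolding fls_times_nth(2) by (auto elim: sum.not_neutral_contains_not_neutral)
    then show "k \<in> ?S" by (intro image_eqI[of _ _ "(i, k - i)"]) auto
  qed
qed

lemma laurent_polynomial_prod:
  "(\<And>i. i \<in> A \<Longrightarrow> laurent_polynomial (f i)) \<Longrightarrow> laurent_polynomial (\<Prod>i\<in>A. f i)"
  by (induction A rule: infinite_finite_induct) (auto intro: laurent_polynomial_mult)

definition lacunary :: "'a::zero fls \<Rightarrow> bool" where
  "lacunary f \<longleftrightarrow> (\<forall>L. \<exists>d>L. f $$ d \<noteq> 0 \<and> (\<forall>j\<in>{d - L..<d}. f $$ j = 0))"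

text \<open>If the gap below \<open>d\<close> is longer than \<open>P\<close>, then only the lowest term of \<open>P\<close> meets the
  \<open>d\<close>-th term of \<open>f\<close>.\<close>

lemma lacunary_mult_laurent_imp_0:
  assumes f: "lacunary f" and P: "laurent_polynomial P" and Pf: "laurent_polynomial (P * f)"
  shows "P = 0"
proof (rule ccontr)
  assume "P \<noteq> 0"
  define a where "a = fls_subdegree P"
  have "bdd_above ({k. P $$ k \<noteq> 0} \<union> {k. (P * f) $$ k \<noteq> 0})"
    using P Pf by (intro bdd_above_finite) (simp add: laurent_polynomial_def)
  then obtain U where U: "\<And>k. P $$ k \<noteq> 0 \<or> (P * f) $$ k \<noteq> 0 \<Longrightarrow> k \<le> U"
    unfolding bdd_above_def by blast
  obtain d where d: "d > \<bar>U\<bar> + \<bar>a\<bar>" "f $$ d \<noteq> 0"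
    and gap: "\<And>j. d - (\<bar>U\<bar> + \<bar>a\<bar>) \<le> j \<Longrightarrow> j < d \<Longrightarrow> f $$ j = 0"
    using f unfolding lacunary_def by (metis atLeastLessThan_iff)
  have "(P * f) $$ (a + d) = (\<Sum>i\<in>{a..a + d - fls_subdegree f}. P $$ i * f $$ (a + d - i))"
    by (simp add: fls_times_nth(2) a_def)
  also have "\<dots> = (\<Sum>i\<in>{a}. P $$ i * f $$ (a + d - i))"
  proof (rule sum.mono_neutral_right)
    show "{a} \<subseteq> {a..a + d - fls_subdegree f}"
      using fls_subdegree_leI[OF d(2)] by simp
    show "\<forall>i\<in>{a..a + d - fls_subdegree f} - {a}. P $$ i * f $$ (a + d - i) = 0"
    proof
      fix i assume "i \<in> {a..a + d - fls_subdegree f} - {a}"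
      then show "P $$ i * f $$ (a + d - i) = 0"
        using U[of i] gap[of "a + d - i"] by (cases "P $$ i = 0") auto
    qed
  qed simp
  also have "\<dots> = P $$ a * f $$ d" by simp
  finally have "(P * f) $$ (a + d) \<noteq> 0"
    using \<open>P \<noteq> 0\<close> d(2) by (simp add: a_def)
  then show False using U[of "a + d"] d(1) by simp
qed

section \<open>The partial theta function\<close>

lemma strict_mono_triangle: "strict_mono triangle"
  by (simp add: strict_mono_Suc_iff)

lemma triangle_ge: "l \<le> triangle l"
  using strict_mono_triangle by (rule strict_mono_imp_increasing)

lemma partial_theta_term_nth:
  "((-1) ^ l * fps_X ^ triangle l :: 'a::comm_ring_1 fps) $ d =
    (if d = triangle l then (-1) ^ l else 0)"
  by (cases "even l") auto

lemma partial_theta_nth: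
  assumes "d < n"
  shows "partial_theta $ d = (\<Sum>l<n. (-1) ^ l * fps_X ^ triangle l) $ d"
proof -
  let ?S = "\<lambda>n. \<Sum>l<n. (-1) ^ l * fps_X ^ triangle l :: complex fps"
  have stable: "?S n $ d = ?S (Suc d) $ d" if "d < n" for n d
    unfolding fps_sum_nth partial_theta_term_nth
    using that by (intro sum.mono_neutral_right) (auto simp: Suc_le_eq leD[OF triangle_ge])
  have "?S \<longlonglongrightarrow> Abs_fps (\<lambda>d. ?S (Suc d) $ d)"
    by (intro tendsto_fpsI eventually_mono[OF eventually_gt_at_top])
      (unfold fps_nth_Abs_fps, rule stable)
  then have "(\<lambda>l. (-1) ^ l * fps_X ^ triangle l) sums Abs_fps (\<lambda>d. ?S (Suc d) $ d)"
    by (simp only: sums_def)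
  then have theta: "partial_theta = Abs_fps (\<lambda>d. ?S (Suc d) $ d)"
    unfolding partial_theta_def Suc_eq_plus1[symmetric] triangle_def[symmetric]
    by (rule sums_unique[symmetric])
  show ?thesis
    unfolding theta fps_nth_Abs_fps by (rule stable[OF assms, symmetric])
qed

lemma partial_theta_nth_triangle: "partial_theta $ triangle l = (-1) ^ l"
proof -
  have "partial_theta $ triangle l = (\<Sum>k<Suc (triangle l). if k = l then (-1) ^ k else 0)"
    unfolding partial_theta_nth[OF lessI] fps_sum_nth partial_theta_term_nth
    by (intro sum.cong) (auto dest: strict_mono_eq[OF strict_mono_triangle, THEN iffD1])
  then show ?thesis using triangle_ge[of l] by (simp add: less_Suc_eq_le)
qed

lemma partial_theta_nth_eq_0: "d \<notin> range triangle \<Longrightarrow> partial_theta $ d = 0"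
  unfolding partial_theta_nth[OF lessI] fps_sum_nth partial_theta_term_nth
  by (intro sum.neutral) auto

abbreviation \<theta> :: "complex fls" where
  "\<theta> \<equiv> fps_to_fls partial_theta"

lemma lacunary_partial_theta: "lacunary \<theta>"
  unfolding lacunary_def
proof
  fix L :: int
  define l where "l = nat \<bar>L\<bar>"
  have L: "L \<le> int l" by (simp add: l_def)
  show "\<exists>d>L. \<theta> $$ d \<noteq> 0 \<and> (\<forall>j\<in>{d - L..<d}. \<theta> $$ j = 0)"
  proof (intro exI conjI ballI)
    show "int (triangle (Suc l)) > L"
      using L triangle_ge[of "Suc l"] by linarith
    show "\<theta> $$ int (triangle (Suc l)) \<noteq> 0"
      by (simp add: partial_theta_nth_triangle del: triangle_Suc)
    fix j assume j: "j \<in> {int (triangle (Suc l)) - L..<int (triangle (Suc l))}"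
    then have between: "triangle l < nat j" "nat j < triangle (Suc l)"
      using L by auto
    have "nat j \<notin> range triangle"
    proof
      assume "nat j \<in> range triangle"
      with between obtain k where "triangle l < triangle k" "triangle k < triangle (Suc l)" by auto
      then show False by (simp only: strict_mono_less[OF strict_mono_triangle])
    qed
    then show "\<theta> $$ j = 0"
      by (simp add: partial_theta_nth_eq_0)
  qed
qed

lemma partial_theta_recurrence:
  assumes "\<And>n. W n = 1 - fps_X ^ Suc n * W (Suc n)"
  shows "W 0 = partial_theta"
proof (rule fps_ext)
  fix d
  have "W 0 = (\<Sum>l<n. (-1) ^ l * fps_X ^ triangle l) + (-1) ^ n * (fps_X ^ triangle n * W n)" for n
  proof (induction n)
    case (Suc n)
    have "(-1) ^ n * (fps_X ^ triangle n * W n) =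
        (-1) ^ n * fps_X ^ triangle n + (-1) ^ Suc n * (fps_X ^ triangle (Suc n) * W (Suc n))"
      by (subst assms) (simp add: power_add algebra_simps)
    with Suc show ?case by simp
  qed simp
  then have "W 0 $ d = (\<Sum>l<Suc d. (-1) ^ l * fps_X ^ triangle l) $ d
      + ((-1) ^ Suc d * (fps_X ^ triangle (Suc d) * W (Suc d))) $ d"
    by (metis fps_add_nth)
  moreover have "((-1) ^ Suc d * (fps_X ^ triangle (Suc d) * W (Suc d))) $ d = 0"
    using triangle_ge[of "Suc d"]
    by (cases "even d") (simp_all add: fps_X_power_mult_nth del: triangle_Suc power_Suc)
  ultimately show "W 0 $ d = partial_theta $ d"
    by (simp only: partial_theta_nth[OF lessI] add_0_right)
qed

definition theta_module :: "complex fls set" where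
  "theta_module = {P * \<theta> + Q | P Q. laurent_polynomial P \<and> laurent_polynomial Q}"

lemma theta_moduleI:
  "f = P * \<theta> + Q \<Longrightarrow> laurent_polynomial P \<Longrightarrow> laurent_polynomial Q \<Longrightarrow> f \<in> theta_module"
  by (auto simp: theta_module_def)

lemma theta_moduleE:
  assumes "f \<in> theta_module"
  obtains P Q where "f = P * \<theta> + Q" "laurent_polynomial P" "laurent_polynomial Q"
  using assms by (auto simp: theta_module_def)

lemma partial_theta_in_theta_module: "\<theta> \<in> theta_module"
  by (rule theta_moduleI[of _ 1 0]) simp_all

lemma one_in_theta_module: "1 \<in> theta_module"
  by (rule theta_moduleI[of _ 0 1]) simp_all

lemma theta_module_add:
  assumes "f \<in> theta_module" "g \<in> theta_module"
  shows "f + g \<in> theta_module"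
proof -
  obtain P Q where f: "f = P * \<theta> + Q" "laurent_polynomial P" "laurent_polynomial Q"
    using assms(1) by (rule theta_moduleE)
  obtain R S where g: "g = R * \<theta> + S" "laurent_polynomial R" "laurent_polynomial S"
    using assms(2) by (rule theta_moduleE)
  show ?thesis using f g
    by (intro theta_moduleI[of _ "P + R" "Q + S"] laurent_polynomial_add)
      (simp_all add: algebra_simps)
qed

lemma theta_module_mult:
  assumes "laurent_polynomial h" "f \<in> theta_module"
  shows "h * f \<in> theta_module"
proof -
  obtain P Q where f: "f = P * \<theta> + Q" "laurent_polynomial P" "laurent_polynomial Q"
    using assms(2) by (rule theta_moduleE)
  show ?thesis using f assms(1)
    by (intro theta_moduleI[of _ "h * P" "h * Q"] laurent_polynomial_mult)
      (simp_all add: algebra_simps)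
qed

lemma theta_module_diff:
  "f \<in> theta_module \<Longrightarrow> g \<in> theta_module \<Longrightarrow> f - g \<in> theta_module"
  using theta_module_add[OF _ theta_module_mult[of "- 1" g], of f] by simp

lemma theta_module_unique:
  assumes "f \<in> theta_module"
  shows "\<exists>!PQ. case PQ of (P, Q) \<Rightarrow>
    laurent_polynomial P \<and> laurent_polynomial Q \<and> f = P * \<theta> + Q"
proof -
  obtain P Q where PQ: "f = P * \<theta> + Q" "laurent_polynomial P" "laurent_polynomial Q"
    using assms by (rule theta_moduleE)
  have unique: "(R, S) = (P, Q)"
    if RS: "f = R * \<theta> + S" "laurent_polynomial R" "laurent_polynomial S" for R S
  proof -
    have "(R - P) * \<theta> = Q - S"
      using PQ(1) RS(1) by (simp add: algebra_simps)
    then have "R - P = 0"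
      using PQ RS by (intro lacunary_mult_laurent_imp_0[OF lacunary_partial_theta])
        (simp_all add: laurent_polynomial_diff)
    with PQ(1) RS(1) show ?thesis by simp
  qed
  show ?thesis
    by (rule ex1I[of _ "(P, Q)"]) (use PQ in blast, use unique in blast)
qed

section \<open>Maya diagrams\<close>

text \<open>The physicists' normal ordering: a sum over the Maya diagram \<open>S\<close> from which the divergent
  contribution of the vacuum \<open>{..<0}\<close> has been subtracted.\<close>

definition normal_ordered_sum :: "(int \<Rightarrow> 'a::ab_group_add) \<Rightarrow> int set \<Rightarrow> 'a" where
  "normal_ordered_sum f S = sum f (S - {..<0}) - sum f ({..<0} - S)"

definition maya_diagrams :: "int set set" where
  "maya_diagrams = {S. finite (S - {..<0}) \<and> finite ({..<0} - S)}"

lemma insert_maya_diagrams_iff: "insert x S \<in> maya_diagrams \<longleftrightarrow> S \<in> maya_diagrams"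
proof -
  have "insert x S - {..<0} = (if x < 0 then S - {..<0} else insert x (S - {..<0}))"
    and "{..<0} - insert x S = ({..<0} - S) - {x}" by auto
  then show ?thesis by (simp add: maya_diagrams_def)
qed

lemma normal_ordered_sum_insert:
  assumes "S \<in> maya_diagrams" "x \<notin> S"
  shows "normal_ordered_sum f (insert x S) = f x + normal_ordered_sum f S"
proof (cases "x < 0")
  case True
  then have "insert x S - {..<0} = S - {..<0}" by auto
  moreover have "sum f ({..<0} - S) = f x + sum f ({..<0} - insert x S)"
    using assms True unfolding Diff_insert[of "{..<0}"]
    by (intro sum.remove) (simp_all add: maya_diagrams_def)
  ultimately show ?thesis by (simp add: normal_ordered_sum_def)
next
  case False
  then have "insert x S - {..<0} = insert x (S - {..<0})" "{..<0} - insert x S = {..<0} - S"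
    by auto
  then show ?thesis using assms by (simp add: normal_ordered_sum_def maya_diagrams_def)
qed

lemma lessThan_1_int: "{..<1 :: int} = insert 0 {..<0}"
  by auto

lemma translate_Diff_vacuum:
  fixes S :: "int set"
  shows "(+) 1 ` S - {..<1} = (+) 1 ` (S - {..<0})" "{..<1} - (+) 1 ` S = (+) 1 ` ({..<0} - S)"
proof -
  have "{..<0 :: int} = {..- 1}" "{..<1 :: int} = {..0}" by auto
  then have "(+) 1 ` {..<0 :: int} = {..<1}" by simp
  then show "(+) 1 ` S - {..<1} = (+) 1 ` (S - {..<0})" "{..<1} - (+) 1 ` S = (+) 1 ` ({..<0} - S)"
    by (simp_all add: image_set_diff)
qed

lemma translate_maya_diagrams_iff: "(+) 1 ` S \<in> maya_diagrams \<longleftrightarrow> S \<in> maya_diagrams"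
proof -
  have "(+) 1 ` S \<in> maya_diagrams \<longleftrightarrow>
      finite ((+) 1 ` S - {..<1}) \<and> finite ({..<1} - (+) 1 ` S)"
    by (simp add: maya_diagrams_def lessThan_1_int insert_Diff_if)
  then show ?thesis
    by (simp add: translate_Diff_vacuum maya_diagrams_def finite_image_iff)
qed

lemma normal_ordered_sum_translate:
  assumes "S \<in> maya_diagrams"
  shows "normal_ordered_sum f ((+) 1 ` S) = f 0 + normal_ordered_sum (\<lambda>x. f (1 + x)) S"
proof -
  let ?T = "(+) 1 ` S"
  have "finite (?T - {..<0})" "finite ({..<0} - ?T)"
    using assms translate_maya_diagrams_iff[of S] by (simp_all add: maya_diagrams_def)
  then have "normal_ordered_sum f ?T = f 0 + (sum f (?T - {..<1}) - sum f ({..<1} - ?T))"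
    unfolding normal_ordered_sum_def lessThan_1_int Diff_insert[of ?T]
    by (cases "0 \<in> ?T") (simp_all add: insert_Diff_if sum_diff1)
  also have "sum f (?T - {..<1}) - sum f ({..<1} - ?T) = normal_ordered_sum (\<lambda>x. f (1 + x)) S"
    unfolding translate_Diff_vacuum normal_ordered_sum_def by (simp add: sum.reindex)
  finally show ?thesis .
qed

abbreviation maya_charge :: "int set \<Rightarrow> int" where
  "maya_charge \<equiv> normal_ordered_sum (\<lambda>_. 1)"

abbreviation maya_energy :: "int set \<Rightarrow> int" where
  "maya_energy \<equiv> normal_ordered_sum (\<lambda>x. x)"

definition neutral_diagrams :: "int \<Rightarrow> int set set" where
  "neutral_diagrams e = {S \<in> maya_diagrams. maya_charge S = 0 \<and> maya_energy S = e}"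

text \<open>Both operations raise the charge by 1; translation also raises the energy by the charge.\<close>

lemma insert_neutral_iff_translate_neutral:
  assumes "x \<notin> S"
  shows "insert x S \<in> neutral_diagrams e \<longleftrightarrow> (+) 1 ` S \<in> neutral_diagrams (e - x - 1)"
proof (cases "S \<in> maya_diagrams")
  case True
  have "normal_ordered_sum (\<lambda>x. 1 + x) S = maya_charge S + maya_energy S"
    by (simp add: normal_ordered_sum_def sum.distrib)
  with True assms show ?thesis
    by (auto simp: neutral_diagrams_def insert_maya_diagrams_iff translate_maya_diagrams_iff
        normal_ordered_sum_insert normal_ordered_sum_translate)
qed (simp add: neutral_diagrams_def insert_maya_diagrams_iff translate_maya_diagrams_iff)

lemma neutral_diagrams_particles_le:
  assumes "S \<in> neutral_diagrams e"
  shows "\<Sum>(S - {..<0}) \<le> e"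
proof -
  have "\<Sum>({..<0} - S) \<le> 0" by (intro sum_nonpos) auto
  then show ?thesis using assms by (simp add: neutral_diagrams_def normal_ordered_sum_def)
qed

lemma neutral_diagrams_mem_le:
  assumes S: "S \<in> neutral_diagrams e" and x: "x \<in> S" "0 \<le> x"
  shows "x \<le> e"
proof -
  have "x \<le> \<Sum>(S - {..<0})"
    using S x by (intro member_le_sum) (auto simp: neutral_diagrams_def maya_diagrams_def)
  also have "\<dots> \<le> e" using S by (rule neutral_diagrams_particles_le)
  finally show ?thesis .
qed

lemma neutral_diagrams_negative: "e < 0 \<Longrightarrow> neutral_diagrams e = {}"
proof (rule equals0I)
  fix S assume "e < 0" "S \<in> neutral_diagrams e"
  moreover have "0 \<le> \<Sum>(S - {..<0})" by (intro sum_nonneg) auto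
  ultimately show False using neutral_diagrams_particles_le by fastforce
qed

lemma neutral_diagrams_no_particles:
  "{S \<in> neutral_diagrams e. S \<inter> {0..} = {}} = (if e = 0 then {{..<0}} else {})"
proof -
  have "S = {..<0}" if S: "S \<in> neutral_diagrams e" "S \<inter> {0..} = {}" for S
  proof -
    have no_particles: "S - {..<0} = {}" using S(2) by auto
    moreover have "card (S - {..<0}) = card ({..<0} - S)" "finite ({..<0} - S)"
      using S(1) by (simp_all add: neutral_diagrams_def normal_ordered_sum_def maya_diagrams_def)
    ultimately have "{..<0} - S = {}" by (metis card.empty card_0_eq)
    with no_particles show ?thesis by auto
  qed
  moreover have "{..<0} \<in> neutral_diagrams e \<longleftrightarrow> e = 0"
    by (auto simp: neutral_diagrams_def maya_diagrams_def normal_ordered_sum_def)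
  ultimately show ?thesis by auto
qed

section \<open>Particles and holes\<close>

definition maya :: "nat set \<Rightarrow> nat set \<Rightarrow> int set" where
  "maya N M = int ` N \<union> ({..<0} - (\<lambda>m. - 1 - int m) ` M)"

lemma maya_particles: "maya N M - {..<0} = int ` N"
  by (auto simp: maya_def)

lemma maya_holes: "{..<0} - maya N M = (\<lambda>m. - 1 - int m) ` M"
  by (auto simp: maya_def)

lemma inj_hole: "inj (\<lambda>m. - 1 - int m)"
  by (simp add: inj_def)

lemma maya_in_maya_diagrams_iff: "maya N M \<in> maya_diagrams \<longleftrightarrow> finite N \<and> finite M"
  using inj_on_subset[OF inj_hole]
  by (simp add: maya_diagrams_def maya_particles maya_holes finite_image_iff)

lemma normal_ordered_sum_maya:
  "normal_ordered_sum f (maya N M) = (\<Sum>n\<in>N. f (int n)) - (\<Sum>m\<in>M. f (- 1 - int m))"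
  unfolding normal_ordered_sum_def maya_particles maya_holes
  by (simp add: sum.reindex inj_on_subset[OF inj_hole])

lemma bij_maya: "bij (\<lambda>(N, M). maya N M)"
proof (rule o_bij)
  have "x \<in> maya {n. int n \<in> S} {m. - 1 - int m \<notin> S} \<longleftrightarrow> x \<in> S" for x S
    by (cases x rule: int_cases) (auto simp: maya_def)
  then show "(\<lambda>(N, M). maya N M) \<circ> (\<lambda>S. ({n. int n \<in> S}, {m. - 1 - int m \<notin> S})) = id"
    by (auto simp: fun_eq_iff)
  show "(\<lambda>S. ({n. int n \<in> S}, {m. - 1 - int m \<notin> S})) \<circ> (\<lambda>(N, M). maya N M) = id"
    by (auto simp: fun_eq_iff maya_def)
qed

lemma charge_eq_maya_charge: "charge N M = maya_charge (maya N M)"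
  by (simp add: charge_def normal_ordered_sum_maya)

lemma energy_eq_maya_energy:
  "energy N M = of_int (maya_energy (maya N M)) + of_int (charge N M) / 2"
  by (simp add: energy_def charge_def normal_ordered_sum_maya sum.distrib sum_negf sum_subtractf
      diff_divide_distrib)

lemma mem_charge0_states_iff:
  "(N, M) \<in> charge0_states d \<longleftrightarrow> maya N M \<in> neutral_diagrams (int d)"
proof -
  have "energy N M = of_nat d \<longleftrightarrow> maya_energy (maya N M) = int d" if "charge N M = 0"
  proof -
    have "energy N M = of_nat d \<longleftrightarrow>
        (of_int (maya_energy (maya N M)) :: rat) = of_int (int d)"
      by (simp add: energy_eq_maya_energy that)
    then show ?thesis by (simp only: of_int_eq_iff)
  qed
  then show ?thesis
    by (auto simp: charge0_states_def neutral_diagrams_def maya_in_maya_diagrams_iff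
        simp flip: charge_eq_maya_charge)
qed

lemma bij_betw_maya_charge0_states:
  "bij_betw (\<lambda>(N, M). maya N M) (charge0_states d) (neutral_diagrams (int d))"
proof (rule bij_betw_subset[OF bij_maya])
  have "charge0_states d = (\<lambda>(N, M). maya N M) -` neutral_diagrams (int d)"
    by (auto simp: mem_charge0_states_iff)
  then show "(\<lambda>(N, M). maya N M) ` charge0_states d = neutral_diagrams (int d)"
    using bij_is_surj[OF bij_maya] by (simp only: surj_image_vimage_eq)
qed simp

lemma finite_neutral_diagrams: "finite (neutral_diagrams e)"
proof (cases "e < 0")
  case False
  then show ?thesis
    using bij_betw_finite[OF bij_betw_maya_charge0_states[of "nat e"]] finite_charge0_states by simp
qed (simp add: neutral_diagrams_negative)

section \<open>Vacancy generating functions\<close>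

definition vacancy_series :: "int set \<Rightarrow> complex fps" where
  "vacancy_series I = Abs_fps (\<lambda>d. of_nat (card {S \<in> neutral_diagrams (int d). S \<inter> I = {}}))"

lemma vacancy_series_nth:
  "fps_to_fls (vacancy_series I) $$ e = of_nat (card {S \<in> neutral_diagrams e. S \<inter> I = {}})"
  by (simp add: vacancy_series_def neutral_diagrams_negative)

lemma card_neutral_diagrams_occupied:
  assumes "x \<notin> I"
  shows "card {S \<in> neutral_diagrams e. S \<inter> I = {} \<and> x \<in> S} =
    card {S \<in> neutral_diagrams (e - x - 1). S \<inter> (+) 1 ` insert x I = {}}"
proof -
  let ?T = "{T. insert x T \<in> neutral_diagrams e \<and> x \<notin> T \<and> T \<inter> I = {}}"
  have occupied: "insert x ` ?T = {S \<in> neutral_diagrams e. S \<inter> I = {} \<and> x \<in> S}"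
  proof (intro equalityI subsetI)
    fix S assume "S \<in> {S \<in> neutral_diagrams e. S \<inter> I = {} \<and> x \<in> S}"
    then show "S \<in> insert x ` ?T"
      by (intro image_eqI[of _ _ "S - {x}"]) (auto simp: insert_absorb)
  qed (use assms in auto)
  have inj_insert: "inj_on (insert x) ?T"
    by (rule inj_onI) (simp add: insert_ident)
  have translated: "(`) ((+) 1) ` ?T =
      {S \<in> neutral_diagrams (e - x - 1). S \<inter> (+) 1 ` insert x I = {}}"
  proof (intro equalityI subsetI)
    fix S assume S: "S \<in> {S \<in> neutral_diagrams (e - x - 1). S \<inter> (+) 1 ` insert x I = {}}"
    have "S = (+) 1 ` (+) (- 1) ` S" by (simp add: image_image)
    then obtain T where T: "S = (+) 1 ` T" by blast
    with S have "(+) 1 ` (T \<inter> insert x I) = {}" by (simp add: image_Int)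
    then have "x \<notin> T" "T \<inter> I = {}" by auto
    with S T show "S \<in> (`) ((+) 1) ` ?T"
      by (simp add: insert_neutral_iff_translate_neutral)
  qed (auto simp: insert_neutral_iff_translate_neutral)
  have inj_translate: "inj_on ((`) ((+) 1)) ?T"
    by (simp add: inj_on_def inj_image_eq_iff)
  show ?thesis
    by (simp only: card_image[OF inj_insert] card_image[OF inj_translate] flip: occupied translated)
qed

lemma vacancy_series_insert:
  assumes "x \<notin> I"
  shows "fps_to_fls (vacancy_series I) = fps_to_fls (vacancy_series (insert x I))
    + fls_X powi (x + 1) * fps_to_fls (vacancy_series ((+) 1 ` insert x I))"
proof (rule fls_eqI)
  fix e
  let ?D = "neutral_diagrams e"
  have "{S \<in> ?D. S \<inter> I = {}} = {S \<in> ?D. S \<inter> insert x I = {}} \<union> {S \<in> ?D. S \<inter> I = {} \<and> x \<in> S}"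
    by auto
  then have "card {S \<in> ?D. S \<inter> I = {}} =
      card {S \<in> ?D. S \<inter> insert x I = {}} + card {S \<in> ?D. S \<inter> I = {} \<and> x \<in> S}"
    by (simp only:) (intro card_Un_disjoint; use finite_neutral_diagrams in auto)
  then show "fps_to_fls (vacancy_series I) $$ e = (fps_to_fls (vacancy_series (insert x I))
      + fls_X powi (x + 1) * fps_to_fls (vacancy_series ((+) 1 ` insert x I))) $$ e"
    by (simp only: fls_plus_nth fls_X_powi_mult_nth vacancy_series_nth
        card_neutral_diagrams_occupied[OF assms] of_nat_add diff_diff_add)
qed

lemma vacancy_series_no_particles: "vacancy_series {0..} = 1"
  by (rule fps_ext) (simp add: vacancy_series_def neutral_diagrams_no_particles)

lemma vacancy_series_atLeast_Suc:
  "(1 - fps_X ^ Suc k) * vacancy_series {int (Suc k)..} = vacancy_series {int k..}"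
proof -
  have "insert (int k) {int (Suc k)..} = {int k..}" "(+) 1 ` {int k..} = {int (Suc k)..}"
    "int k + 1 = int (Suc k)" by auto
  then have "fps_to_fls (vacancy_series {int (Suc k)..}) =
      fps_to_fls (vacancy_series {int k..} + fps_X ^ Suc k * vacancy_series {int (Suc k)..})"
    using vacancy_series_insert[of "int k" "{int (Suc k)..}"]
    by (simp only: fps_to_fls_plus fls_times_fps_to_fls fps_to_fls_X_power) simp
  then have "vacancy_series {int (Suc k)..} =
      vacancy_series {int k..} + fps_X ^ Suc k * vacancy_series {int (Suc k)..}"
    by (simp only: fps_to_fls_eq_iff)
  then show ?thesis by (simp only: left_diff_distrib mult_1 diff_eq_eq)
qed

lemma vacancy_series_atLeast_nth:
  assumes "d < k"
  shows "vacancy_series {int k..} $ d = vacancy_series {} $ d"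
proof -
  have "{S \<in> neutral_diagrams (int d). S \<inter> {int k..} = {}} =
      {S \<in> neutral_diagrams (int d). S \<inter> {} = {}}"
    using assms by (auto dest: neutral_diagrams_mem_le)
  then show ?thesis by (simp only: vacancy_series_def fps_nth_Abs_fps)
qed

lemma prod_mult_vacancy_series_atLeast:
  "(\<Prod>m<k. 1 - fps_X ^ Suc m) * vacancy_series {int k..} = 1"
proof (induction k)
  case 0
  show ?case by (simp add: vacancy_series_no_particles)
next
  case (Suc k)
  then show ?case by (simp only: prod.lessThan_Suc mult.assoc vacancy_series_atLeast_Suc)
qed

definition euler_product :: "complex fps" where
  "euler_product = prodinf (\<lambda>m. 1 - fps_X ^ Suc m)"

lemma euler_product_mult_vacancy_series: "euler_product * vacancy_series {} = 1"
proof -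
  let ?E = "\<lambda>k. vacancy_series {int k..}" and ?V = "vacancy_series {}"
  have V_nth_0: "?V $ 0 = 1"
    using arg_cong[OF prod_mult_vacancy_series_atLeast[of 1], of "\<lambda>f. f $ 0"]
      vacancy_series_atLeast_nth[of 0 1] by simp
  have "?E \<longlonglongrightarrow> ?V"
    by (intro tendsto_fpsI eventually_mono[OF eventually_gt_at_top])
      (rule vacancy_series_atLeast_nth)
  then have "(\<lambda>k. inverse (?E (Suc k))) \<longlonglongrightarrow> inverse ?V"
    using V_nth_0 by (intro tendsto_inverse_fps LIMSEQ_Suc) simp_all
  moreover have "inverse (?E (Suc k)) = (\<Prod>m\<le>k. 1 - fps_X ^ Suc m)" for k
    using prod_mult_vacancy_series_atLeast[of "Suc k"]
    by (metis fps_inverse_unique lessThan_Suc_atMost mult.commute)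
  ultimately have "(\<lambda>k. \<Prod>m\<le>k. 1 - fps_X ^ Suc m) \<longlonglongrightarrow> inverse ?V"
    by (simp only:)
  moreover have "inverse ?V \<noteq> 0" using V_nth_0 by auto
  ultimately have "(\<lambda>m. 1 - fps_X ^ Suc m) has_prod inverse ?V"
    by (simp add: has_prod_def raw_has_prod_def)
  then have "euler_product = inverse ?V"
    unfolding euler_product_def by (rule has_prod_unique[symmetric])
  then show ?thesis using V_nth_0 by (metis inverse_mult_eq_1 zero_neq_one)
qed

text \<open>By Euler's identity this is the quotient of \<open>vacancy_series I\<close> by \<open>vacancy_series {}\<close>.\<close>

definition vacancy_ratio :: "int set \<Rightarrow> complex fls" where
  "vacancy_ratio I = fps_to_fls (euler_product * vacancy_series I)"

lemma vacancy_ratio_empty: "vacancy_ratio {} = 1"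
  by (simp only: vacancy_ratio_def euler_product_mult_vacancy_series fps_one_to_fls)

lemma vacancy_ratio_insert:
  "x \<notin> I \<Longrightarrow> vacancy_ratio I =
    vacancy_ratio (insert x I) + fls_X powi (x + 1) * vacancy_ratio ((+) 1 ` insert x I)"
  unfolding vacancy_ratio_def fls_times_fps_to_fls
  by (subst vacancy_series_insert) (simp_all add: distrib_left mult.left_commute)

lemma vacancy_ratio_singleton_Suc:
  "vacancy_ratio {x} = 1 - fls_X powi (x + 1) * vacancy_ratio {x + 1}"
  using vacancy_ratio_insert[of x "{}"] by (simp add: vacancy_ratio_empty eq_diff_eq add.commute)

lemma vacancy_ratio_singleton_0: "vacancy_ratio {0} = \<theta>"
proof -
  define W where "W n = euler_product * vacancy_series {int n}" for n
  have W: "fps_to_fls (W n) = vacancy_ratio {int n}" for n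
    by (simp add: W_def vacancy_ratio_def)
  have "W n = 1 - fps_X ^ Suc n * W (Suc n)" for n
  proof (rule fps_to_fls_eq_iff[THEN iffD1])
    have "int n + 1 = int (Suc n)" by simp
    with vacancy_ratio_singleton_Suc[of "int n"]
    show "fps_to_fls (W n) = fps_to_fls (1 - fps_X ^ Suc n * W (Suc n))"
      by (simp only: fps_to_fls_minus fps_one_to_fls fls_times_fps_to_fls fps_to_fls_X_power W)
  qed
  then have "W 0 = partial_theta" by (rule partial_theta_recurrence)
  with W[of 0] show ?thesis by simp
qed

lemma vacancy_ratio_singleton: "vacancy_ratio {x} \<in> theta_module"
proof (induction x rule: int_induct[where k = 0])
  case base
  show ?case by (simp add: vacancy_ratio_singleton_0 partial_theta_in_theta_module)
next
  case (step1 x)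
  have "vacancy_ratio {x + 1} = fls_X powi (- (x + 1)) * (1 - vacancy_ratio {x})"
    by (simp add: vacancy_ratio_singleton_Suc[of x] flip: mult.assoc power_int_add)
  with step1 show ?case
    by (simp only: theta_module_mult theta_module_diff one_in_theta_module
        laurent_polynomial_X_powi)
next
  case (step2 x)
  then show ?case
    unfolding vacancy_ratio_singleton_Suc[of "x - 1"]
    by (simp add: theta_module_mult theta_module_diff one_in_theta_module)
qed

text \<open>Removing the particle at \<open>a\<close> and removing the one at \<open>b\<close> lead to the same translated term,
  which cancels.\<close>

lemma vacancy_ratio_partial_fractions:
  assumes "a \<notin> I" "b \<notin> I" "a \<noteq> b"
  shows "(1 - fls_X powi (b - a)) * vacancy_ratio (insert a (insert b I)) =
    vacancy_ratio (insert a I) - fls_X powi (b - a) * vacancy_ratio (insert b I)"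
proof -
  let ?V = "vacancy_ratio (insert a (insert b I))"
    and ?T = "vacancy_ratio ((+) 1 ` insert a (insert b I))"
  have "vacancy_ratio (insert a I) = ?V + fls_X powi (b + 1) * ?T"
    using vacancy_ratio_insert[of b "insert a I"] assms by (simp only: insert_commute) simp
  moreover have "vacancy_ratio (insert b I) = ?V + fls_X powi (a + 1) * ?T"
    using assms by (intro vacancy_ratio_insert) simp
  moreover have "fls_X powi (b + 1) = fls_X powi (b - a) * (fls_X powi (a + 1) :: complex fls)"
    by (simp flip: power_int_add)
  ultimately show ?thesis by (simp add: algebra_simps)
qed

section \<open>Products over pairs of sites\<close>

definition pair_factor :: "int \<Rightarrow> int \<Rightarrow> complex fls" where
  "pair_factor a b = 1 - fls_X powi \<bar>a - b\<bar>"

definition ordered_pairs :: "'i::linorder set \<Rightarrow> ('i \<times> 'i) set" where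
  "ordered_pairs J = {(k, l). k \<in> J \<and> l \<in> J \<and> k < l}"

definition pair_product :: "('i::linorder \<Rightarrow> int) \<Rightarrow> 'i set \<Rightarrow> complex fls" where
  "pair_product y J = (\<Prod>(k, l)\<in>ordered_pairs J. pair_factor (y k) (y l))"

lemma pair_factor_commute: "pair_factor a b = pair_factor b a"
  by (simp add: pair_factor_def abs_minus_commute)

lemma laurent_polynomial_pair_factor: "laurent_polynomial (pair_factor a b)"
  by (simp add: pair_factor_def laurent_polynomial_diff)

lemma finite_ordered_pairs: "finite J \<Longrightarrow> finite (ordered_pairs J)"
  unfolding ordered_pairs_def by (rule finite_subset[of _ "J \<times> J"]) auto

lemma pair_product_singleton: "pair_product y {a} = 1"
proof -
  have "ordered_pairs {a} = {}" by (auto simp: ordered_pairs_def)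
  then show ?thesis by (simp add: pair_product_def)
qed

lemma pair_product_insert:
  assumes "finite J" "a \<notin> J"
  shows "pair_product y (insert a J) = pair_product y J * (\<Prod>i\<in>J. pair_factor (y a) (y i))"
proof -
  let ?h = "\<lambda>i. if i < a then (i, a) else (a, i)" and ?g = "\<lambda>(k, l). pair_factor (y k) (y l)"
  have "ordered_pairs (insert a J) = ordered_pairs J \<union> ?h ` J"
    using assms(2) by (auto simp: ordered_pairs_def image_iff) (metis linorder_neqE)
  then have "pair_product y (insert a J) = prod ?g (ordered_pairs J \<union> ?h ` J)"
    by (simp only: pair_product_def)
  also have "\<dots> = pair_product y J * prod ?g (?h ` J)"
    unfolding pair_product_def using assms
    by (intro prod.union_disjoint finite_ordered_pairs) (auto simp: ordered_pairs_def)
  also have "prod ?g (?h ` J) = (\<Prod>i\<in>J. pair_factor (y a) (y i))"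
  proof -
    have "inj_on ?h J" by (auto simp: inj_on_def split: if_splits)
    then show ?thesis by (subst prod.reindex) (auto simp: pair_factor_commute intro!: prod.cong)
  qed
  finally show ?thesis .
qed

lemma pair_product_Un:
  assumes fin: "finite J" "finite K" and less: "\<And>j k. j \<in> J \<Longrightarrow> k \<in> K \<Longrightarrow> j < k"
  shows "pair_product y (J \<union> K) =
    (\<Prod>j\<in>J. \<Prod>k\<in>K. pair_factor (y j) (y k)) * pair_product y J * pair_product y K"
proof -
  let ?g = "\<lambda>(k, l). pair_factor (y k) (y l)"
  have "ordered_pairs (J \<union> K) = J \<times> K \<union> ordered_pairs J \<union> ordered_pairs K"
    using less by (auto simp: ordered_pairs_def dest: less_asym)
  then have "pair_product y (J \<union> K) = prod ?g (J \<times> K \<union> ordered_pairs J \<union> ordered_pairs K)"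
    by (simp only: pair_product_def)
  also have "\<dots> = prod ?g (J \<times> K \<union> ordered_pairs J) * pair_product y K"
    unfolding pair_product_def using fin
    by (intro prod.union_disjoint finite_ordered_pairs finite_UnI)
      (auto simp: ordered_pairs_def dest: less)
  also have "prod ?g (J \<times> K \<union> ordered_pairs J) = prod ?g (J \<times> K) * pair_product y J"
    unfolding pair_product_def using fin
    by (intro prod.union_disjoint finite_ordered_pairs finite_UnI)
      (auto simp: ordered_pairs_def dest: less)
  finally show ?thesis by (simp add: prod.cartesian_product)
qed

lemma fps_to_fls_pair_factor:
  "\<bar>a - b\<bar> = int d \<Longrightarrow> fps_to_fls (1 - fps_X ^ d) = pair_factor a b"
  by (simp add: pair_factor_def fps_to_fls_X_power)

lemma fps_to_fls_pair_product:
  assumes "\<And>k l. k \<in> J \<Longrightarrow> l \<in> J \<Longrightarrow> k < l \<Longrightarrow> \<bar>y k - y l\<bar> = int (d k l)"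
  shows "fps_to_fls (\<Prod>(k, l)\<in>ordered_pairs J. 1 - fps_X ^ d k l) = pair_product y J"
  unfolding pair_product_def fps_to_fls_prod
  by (intro prod.cong)
    (auto simp: ordered_pairs_def assms fps_to_fls_pair_factor simp del: fps_to_fls_minus)

lemma pair_factor_vacancy_ratio:
  assumes "a \<notin> I" "b \<notin> I" "a \<noteq> b"
  obtains u v where "laurent_polynomial u" "laurent_polynomial v"
    "pair_factor a b * vacancy_ratio (insert a (insert b I)) =
      u * vacancy_ratio (insert a I) + v * vacancy_ratio (insert b I)"
proof (cases "a < b")
  case True
  then have "pair_factor a b = 1 - fls_X powi (b - a)" by (simp add: pair_factor_def)
  then show ?thesis
    using that[of 1 "- (fls_X powi (b - a))"] vacancy_ratio_partial_fractions[OF assms] by simp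
next
  case False
  then have "pair_factor a b = 1 - fls_X powi (a - b)" by (simp add: pair_factor_def)
  then show ?thesis
    using that[of "- (fls_X powi (a - b))" 1] vacancy_ratio_partial_fractions[of b I a] assms
    by (simp add: insert_commute)
qed

lemma pair_product_vacancy_ratio:
  assumes "finite K" "a \<notin> K" "inj_on y (insert a K)"
  shows "pair_product y (insert a K) * vacancy_ratio (y ` insert a K) \<in> theta_module"
  using assms
proof (induction K arbitrary: a rule: finite_induct)
  case empty
  show ?case by (simp add: pair_product_singleton vacancy_ratio_singleton)
next
  case (insert b K)
  let ?F = "\<lambda>c. \<Prod>i\<in>K. pair_factor (y c) (y i)" and ?V = "\<lambda>J. vacancy_ratio (y ` J)"
  have sites: "y a \<notin> y ` K" "y b \<notin> y ` K" "y a \<noteq> y b"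
    using insert.prems insert.hyps by (auto simp: inj_on_def)
  obtain u v where uv: "laurent_polynomial u" "laurent_polynomial v"
    and fractions: "pair_factor (y a) (y b) * ?V (insert a (insert b K)) =
      u * ?V (insert a K) + v * ?V (insert b K)"
    using pair_factor_vacancy_ratio[OF sites] unfolding image_insert[symmetric] by blast
  have "pair_product y (insert a (insert b K)) * ?V (insert a (insert b K)) =
      pair_product y K * ?F a * ?F b * (pair_factor (y a) (y b) * ?V (insert a (insert b K)))"
    using insert.hyps insert.prems by (simp add: pair_product_insert mult_ac)
  also have "\<dots> = (u * ?F b) * (pair_product y (insert a K) * ?V (insert a K))
      + (v * ?F a) * (pair_product y (insert b K) * ?V (insert b K))"
    unfolding fractions using insert.hyps insert.prems
    by (simp add: pair_product_insert distrib_left mult_ac)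
  also have "\<dots> \<in> theta_module"
    using insert.hyps insert.prems uv
    by (intro theta_module_add theta_module_mult insert.IH laurent_polynomial_mult
        laurent_polynomial_prod laurent_polynomial_pair_factor) (auto simp: inj_on_def)
  finally show ?case .
qed

section \<open>The trace over the charge 0 space\<close>

context fermionic_fock
begin

definition psi_mode :: "int \<Rightarrow> 'v \<Rightarrow> 'v" where
  "psi_mode k = \<psi> (of_int k + 1/2)"

definition psi_star_mode :: "int \<Rightarrow> 'v \<Rightarrow> 'v" where
  "psi_star_mode k = \<psi>s (of_int k + 1/2)"

lemma linear_psi_mode: "Vector_Spaces.linear scale scale (psi_mode k)"
  and linear_psi_star_mode: "Vector_Spaces.linear scale scale (psi_star_mode k)"
  unfolding psi_mode_def psi_star_mode_def by (rule linear_psi, rule linear_psi_star)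

interpretation psi_mode: Vector_Spaces.linear scale scale "psi_mode k" for k
  by (rule linear_psi_mode)

interpretation psi_star_mode: Vector_Spaces.linear scale scale "psi_star_mode k" for k
  by (rule linear_psi_star_mode)

lemma psi_mode_anticommute: "psi_mode j (psi_mode k v) = - psi_mode k (psi_mode j v)"
  and psi_star_mode_anticommute:
    "psi_star_mode j (psi_star_mode k v) = - psi_star_mode k (psi_star_mode j v)"
  using anticomm_psi_psi[of j k v] anticomm_star_star[of j k v]
  by (simp_all add: psi_mode_def psi_star_mode_def eq_neg_iff_add_eq_0)

lemma psi_star_mode_psi_mode: "psi_star_mode l (psi_mode k v) =
    (if l + k + 1 = 0 then v else 0) - psi_mode k (psi_star_mode l v)"
  using anticomm_star_psi[of l k v] unfolding psi_mode_def psi_star_mode_def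
  by (simp only: eq_diff_eq)

lemma eq_minus_self_imp_0:
  fixes v :: 'v
  assumes "v = - v"
  shows "v = 0"
proof -
  have "scale 2 v = v + v" using scale_left_distrib[of 1 1 v] by simp
  also have "\<dots> = 0" using assms by (simp add: eq_neg_iff_add_eq_0)
  finally show ?thesis by simp
qed

lemma psi_mode_twice: "psi_mode k (psi_mode k v) = 0"
  and psi_star_mode_twice: "psi_star_mode k (psi_star_mode k v) = 0"
  by (rule eq_minus_self_imp_0, rule psi_mode_anticommute psi_star_mode_anticommute)+

definition vacancy_op :: "int \<Rightarrow> 'v \<Rightarrow> 'v" where
  "vacancy_op x v = psi_star_mode x (psi_mode (- 1 - x) v)"

lemma A_coeff_eq_vacancy_op: "A_coeff (- of_int x - 1/2) = vacancy_op x"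
proof
  fix v
  have "- of_int x - 1/2 = (of_int (- 1 - x) + 1/2 :: rat)"
    "- (of_int (- 1 - x) + 1/2) = (of_int x + 1/2 :: rat)" by simp_all
  moreover have "\<exists>l::int. (- of_int x - 1/2 :: rat) = - of_int l - 1/2" by blast
  ultimately show "A_coeff (- of_int x - 1/2) v = vacancy_op x v"
    unfolding A_coeff_def vacancy_op_def psi_mode_def psi_star_mode_def by (simp only: if_True)
qed

lemma vacancy_op_0: "vacancy_op x 0 = 0"
  by (simp add: vacancy_op_def)

lemma vacancy_op_psi_mode:
  "vacancy_op x (psi_mode j v) = (if j = - 1 - x then 0 else psi_mode j (vacancy_op x v))"
proof (cases "j = - 1 - x")
  case True
  then show ?thesis by (simp add: vacancy_op_def psi_mode_twice)
next
  case False
  have "vacancy_op x (psi_mode j v) = - psi_star_mode x (psi_mode j (psi_mode (- 1 - x) v))"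
    by (simp add: vacancy_op_def psi_mode_anticommute[of "- 1 - x" j] psi_star_mode.neg)
  also have "\<dots> = psi_mode j (vacancy_op x v)"
    using False by (simp add: vacancy_op_def psi_star_mode_psi_mode[of x j])
  finally show ?thesis using False by simp
qed

lemma vacancy_op_psi_star_mode:
  "vacancy_op x (psi_star_mode j v) =
    (if j = x then psi_star_mode j v else psi_star_mode j (vacancy_op x v))"
proof -
  have "vacancy_op x (psi_star_mode j v) =
      psi_star_mode x ((if j = x then v else 0) - psi_star_mode j (psi_mode (- 1 - x) v))"
    using psi_star_mode_psi_mode[of j "- 1 - x" v] by (simp add: vacancy_op_def)
  then show ?thesis
    by (simp add: vacancy_op_def psi_star_mode.diff psi_star_mode_twice
        psi_star_mode_anticommute[of x j])
qed

lemma vacancy_op_vac: "vacancy_op x vac = (if x \<ge> 0 then vac else 0)"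
proof (cases "x \<ge> 0")
  case True
  then have "psi_star_mode x vac = 0" by (simp add: psi_star_mode_def psi_star_vac)
  then show ?thesis
    using True by (simp add: vacancy_op_def psi_star_mode_psi_mode)
next
  case False
  then have "psi_mode (- 1 - x) vac = 0" unfolding psi_mode_def by (intro psi_vac) simp
  then show ?thesis
    using False by (simp add: vacancy_op_def)
qed

abbreviation create_particles :: "nat list \<Rightarrow> 'v \<Rightarrow> 'v" where
  "create_particles \<equiv> fold (\<lambda>n. psi_mode (- 1 - int n))"

abbreviation create_holes :: "nat list \<Rightarrow> 'v \<Rightarrow> 'v" where
  "create_holes \<equiv> fold (\<lambda>m. psi_star_mode (- 1 - int m))"

lemma vacancy_op_create_particles:
  "vacancy_op x (create_particles ns v) =
    (if x \<in> int ` set ns then 0 else create_particles ns (vacancy_op x v))"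
  by (induction ns rule: rev_induct) (auto simp: vacancy_op_psi_mode)

lemma vacancy_op_create_holes:
  "vacancy_op x (create_holes ms v) =
    (if x \<in> (\<lambda>m. - 1 - int m) ` set ms then create_holes ms v
     else create_holes ms (vacancy_op x v))"
  by (induction ms rule: rev_induct) (auto simp: vacancy_op_psi_star_mode)

lemma create_particles_0: "create_particles ns 0 = 0"
  and create_holes_0: "create_holes ns 0 = 0"
  by (induction ns) simp_all

lemma monomial_eq_create:
  "monomial N M = create_particles (sorted_list_of_set N)
    (create_holes (sorted_list_of_set M) vac)"
proof -
  have "(of_int (- 1 - int k) + 1/2 :: rat) = - of_nat k - 1/2" for k by simp
  then show ?thesis unfolding fock_monomial_def psi_mode_def psi_star_mode_def by (simp only:)
qed

lemma vacancy_op_monomial: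
  assumes "finite N" "finite M"
  shows "vacancy_op x (monomial N M) = (if x \<in> maya N M then 0 else monomial N M)"
  unfolding monomial_eq_create vacancy_op_create_particles vacancy_op_create_holes
    vacancy_op_vac
  using assms by (auto simp: maya_def create_particles_0 create_holes_0)

lemma foldr_vacancy_op_monomial:
  assumes "finite N" "finite M"
  shows "foldr (\<lambda>j. vacancy_op (y j)) js (monomial N M) =
    (if maya N M \<inter> y ` set js = {} then monomial N M else 0)"
  by (induction js) (auto simp: vacancy_op_monomial[OF assms] vacancy_op_0)

lemma trace_vacancy_ops:
  "trace_charge0 (foldr (\<lambda>j. vacancy_op (y j)) js) = vacancy_series (y ` set js)"
proof (rule fps_ext)
  fix d
  let ?I = "y ` set js"
  have independent: "independent monomials"
    using independent_monomials by (simp add: monomials_def)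
  have diagonal: "representation monomials
      (foldr (\<lambda>j. vacancy_op (y j)) js (monomial N M)) (monomial N M) =
      (if maya N M \<inter> ?I = {} then 1 else 0)" if "(N, M) \<in> charge0_states d" for N M
  proof -
    have fin: "finite N" "finite M" using that by (simp_all add: charge0_states_def)
    then have "monomial N M \<in> monomials" by (auto simp: monomials_def)
    then show ?thesis
      by (simp add: foldr_vacancy_op_monomial[OF fin] representation_basis[OF independent]
          representation_zero)
  qed
  have "trace_charge0 (foldr (\<lambda>j. vacancy_op (y j)) js) $ d =
      (\<Sum>(N, M)\<in>charge0_states d. if maya N M \<inter> ?I = {} then 1 else 0)"
    unfolding trace_charge0_def fps_nth_Abs_fps
    by (intro sum.cong refl, clarify) (rule diagonal)
  also have "\<dots> = (\<Sum>S\<in>neutral_diagrams (int d). if S \<inter> ?I = {} then 1 else 0)"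
    by (subst sum.reindex_bij_betw[OF bij_betw_maya_charge0_states, symmetric])
      (simp add: case_prod_unfold)
  also have "\<dots> = vacancy_series ?I $ d"
    by (simp add: vacancy_series_def sum.If_cases finite_neutral_diagrams Int_def)
  finally show "trace_charge0 (foldr (\<lambda>j. vacancy_op (y j)) js) $ d = vacancy_series ?I $ d" .
qed

end

definition site :: "nat \<Rightarrow> (nat \<Rightarrow> nat) \<Rightarrow> (nat \<Rightarrow> nat) \<Rightarrow> nat \<Rightarrow> int" where
  "site m r s j = (if j \<le> m then - int (r j) - 1 else int (s j))"

lemma (in fermionic_fock) G_eq_vacancy_ratio:
  "fps_to_fls (G n m r s) = vacancy_ratio (site m r s ` {1..n})"
proof -
  have "(if j \<le> m then of_nat (r j) + 1/2 else - of_nat (s j) - 1/2 :: rat) =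
      - of_int (site m r s j) - 1/2" for j
    by (simp add: site_def)
  then have "G n m r s =
      euler_product * trace_charge0 (foldr (\<lambda>j. vacancy_op (site m r s j)) [1..<Suc n])"
    unfolding G_def npoint_coeff_def euler_product_def by (simp only: A_coeff_eq_vacancy_op)
  then show ?thesis
    by (simp only: trace_vacancy_ops vacancy_ratio_def set_upt atLeastLessThanSuc_atLeastAtMost)
qed

lemma pair_product_site:
  assumes m: "m \<le> n"
    and r: "strict_antimono_on {1..m} r"
    and s: "strict_antimono_on {m + 1..n} s"
  shows "pair_product (site m r s) {1..n} = fps_to_fls
     ((\<Prod>j=1..m. \<Prod>k=m+1..n. 1 - fps_X ^ (r j + s k + 1)) *
      (\<Prod>(k, l)\<in>{(k, l). 1 \<le> k \<and> k < l \<and> l \<le> m}. 1 - fps_X ^ (r k - r l)) *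
      (\<Prod>(k, l)\<in>{(k, l). m + 1 \<le> k \<and> k < l \<and> l \<le> n}. 1 - fps_X ^ (s k - s l)))"
proof -
  let ?y = "site m r s"
  have pairs: "{(k, l). a \<le> k \<and> k < l \<and> l \<le> b} = ordered_pairs {a..b}"
    for a b :: nat by (auto simp: ordered_pairs_def)
  have "{1..n} = {1..m} \<union> {m + 1..n}" using m by auto
  then have "pair_product ?y {1..n} = (\<Prod>j=1..m. \<Prod>k=m+1..n. pair_factor (?y j) (?y k)) *
      pair_product ?y {1..m} * pair_product ?y {m + 1..n}"
    by (simp only:) (intro pair_product_Un; simp)
  also have "pair_product ?y {1..m} =
      fps_to_fls (\<Prod>(k, l)\<in>{(k, l). 1 \<le> k \<and> k < l \<and> l \<le> m}. 1 - fps_X ^ (r k - r l))"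
    unfolding pairs using monotone_onD[OF r]
    by (intro fps_to_fls_pair_product[symmetric]) (fastforce simp: site_def)
  also have "pair_product ?y {m + 1..n} =
      fps_to_fls (\<Prod>(k, l)\<in>{(k, l). m + 1 \<le> k \<and> k < l \<and> l \<le> n}. 1 - fps_X ^ (s k - s l))"
    unfolding pairs using monotone_onD[OF s]
    by (intro fps_to_fls_pair_product[symmetric]) (fastforce simp: site_def)
  also have "(\<Prod>j=1..m. \<Prod>k=m+1..n. pair_factor (?y j) (?y k)) =
      fps_to_fls (\<Prod>j=1..m. \<Prod>k=m+1..n. 1 - fps_X ^ (r j + s k + 1))"
    unfolding fps_to_fls_prod
    by (intro prod.cong refl fps_to_fls_pair_factor[symmetric]) (simp add: site_def)
  finally show ?thesis by (simp only: fls_times_fps_to_fls)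
qed

theorem theorem1p2:
  fixes scale :: "complex \<Rightarrow> 'v::ab_group_add \<Rightarrow> 'v"
    and \<psi> \<psi>s :: "rat \<Rightarrow> 'v \<Rightarrow> 'v" and vac :: 'v
    and n m :: nat and r s :: "nat \<Rightarrow> nat"
  assumes fock: "fermionic_fock scale \<psi> \<psi>s vac"
    and n: "n \<ge> 1" and m: "m \<le> n"
    and r: "\<And>j k. 1 \<le> j \<Longrightarrow> j < k \<Longrightarrow> k \<le> m \<Longrightarrow> r j > r k"
    and s: "\<And>j k. m + 1 \<le> j \<Longrightarrow> j < k \<Longrightarrow> k \<le> n \<Longrightarrow> s j > s k"
    and rs: "\<And>j k. 1 \<le> j \<Longrightarrow> j \<le> m \<Longrightarrow> m + 1 \<le> k \<Longrightarrow> k \<le> n \<Longrightarrow>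
               - (of_nat (r j) :: rat) - 1/2 \<noteq> of_nat (s k) + 1/2"
  shows "\<exists>!PQ. case PQ of (P, Q) \<Rightarrow>
           laurent_polynomial P \<and> laurent_polynomial Q \<and>
           fps_to_fls
             ((\<Prod>j=1..m. \<Prod>k=m+1..n. 1 - fps_X ^ (r j + s k + 1)) *
              (\<Prod>(k, l)\<in>{(k, l). 1 \<le> k \<and> k < l \<and> l \<le> m}. 1 - fps_X ^ (r k - r l)) *
              (\<Prod>(k, l)\<in>{(k, l). m + 1 \<le> k \<and> k < l \<and> l \<le> n}. 1 - fps_X ^ (s k - s l)) *
              fermionic_fock.G scale \<psi> \<psi>s vac n m r s)
           = P * fps_to_fls partial_theta + Q"
proof -
  let ?y = "site m r s"
  have "?y j \<noteq> ?y k" if "j \<in> {1..n}" "k \<in> {1..n}" "j < k" for j k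
    using that r[of j k] s[of j k] by (auto simp: site_def)
  then have inj: "inj_on ?y {1..n}"
    by (intro linorder_inj_onI) auto
  have "{1..n} = insert 1 {2..n}" using n by auto
  with inj have in_theta_module:
    "pair_product ?y {1..n} * vacancy_ratio (?y ` {1..n}) \<in> theta_module"
    by (simp only:) (intro pair_product_vacancy_ratio; simp)
  have anti: "strict_antimono_on {1..m} r" "strict_antimono_on {m + 1..n} s"
    using r s by (auto simp: monotone_on_def)
  from theta_module_unique[OF in_theta_module] show ?thesis
    by (simp only: pair_product_site[OF m anti] fls_times_fps_to_fls
        fermionic_fock.G_eq_vacancy_ratio[OF fock])
qed

end
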